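(* Let $(X,D)$ be a marked smooth projective curve, $r\ge2$ and $d\in\mathbb{Z}$. Let $$\Delta=\{\alpha=(\alpha_i(x))\in[0,1)^{r|D|}:\ \alpha_i(x)<\alpha_{i+1}(x)\ \text{for all }x\in D\text{ and all }i=1,\dots,r-1\}$$ be the space of full flag systems of weights of rank $r$ over $(X,D)$. Then there is a finite number of stability chambers in $\Delta$ (for parabolic vector bundles of rank $r$ and degree $d$).
   Context: A marked curve $(X,D)$ is an irreducible smooth complex projective curve $X$ with a finite set $D\subset X$ of $|D|\ge 1$ distinct points. A (full flag) quasi-parabolic vector bundle $(E,E_\bullet)$ of rank $r$ on $(X,D)$ is a rank $r$ vector bundle $E$ on $X$ with, for each $x\in D$, a full flag $E|_x=E_{x,1}\supsetneq\cdots\supsetneq E_{x,r}\supsetneq E_{x,r+1}=0$. For a nonzero subbundle $F\subseteq E$ put $n^F_i(x)=\dim(F|_x\cap E_{x,i})-\dim(F|_x\cap E_{x,i+1})$ and $\mathrm{pardeg}_\alpha(F)=\deg F+\sum_{x\in D}\sum_{i=1}^r n_i^F(x)\alpha_i(x)$. $(E,E_\bullet)$ is $\alpha$-semistable if $\mathrm{pardeg}_\alpha(F)/\mathrm{rk}F\le\mathrm{pardeg}_\alpha(E)/\mathrm{rk}E$ for every proper nonzero subbundle $F\subsetneq E$. Two systems of weights $\alpha,\beta\in\Delta$ belong to the same stability chamber if every full flag quasi-parabolic bundle of rank $r$ and degree $d$ on $(X,D)$ is $\alpha$-semistable if and only if it is $\beta$-semistable. *)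

theory Defs
  imports
    "HOL-Analysis.Abstract_Topology"
    "HOL-Library.Function_Algebras"
    "HOL-Library.Poly_Mapping"
    "HOL-Library.Extended_Nat"
    "HOL-Library.FuncSet"
    "Jordan_Normal_Form.Determinant"
begin

section \<open>The complex vector space of sequences\<close>

text \<open>
  All affine and projective spaces, and all fibres of vector bundles, are realised inside
  the complex vector space of sequences.
\<close>

type_synonym cvec = "nat \<Rightarrow> complex"

definition cscale :: "complex \<Rightarrow> cvec \<Rightarrow> cvec" where
  "cscale c v = (\<lambda>i. c * v i)"

global_interpretation cvec: vector_space cscale
  defines cspan = cvec.span
    and csubspace = cvec.subspace
    and cindependent = "\<lambda>S. \<not> cvec.dependent S"
    and cdim = cvec.dim
  by unfold_locales (auto simp: cscale_def fun_eq_iff algebra_simps)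


section \<open>Projective space and the Zariski topology\<close>

text \<open>A point of projective space is a line through the origin, with the origin removed.\<close>

type_synonym pt = "cvec set"

definition proj_pt :: "cvec \<Rightarrow> pt" where
  "proj_pt v = {cscale c v |c. c \<noteq> 0}"

definition proj_space :: "nat \<Rightarrow> pt set" where
  "proj_space n = {proj_pt v |v. v \<noteq> 0 \<and> (\<forall>i>n. v i = 0)}"

text \<open>Polynomials in the variables \<open>x\<^sub>0, x\<^sub>1, \<dots>\<close>: finitely supported maps from monomials to coefficients.\<close>

type_synonym cpoly = "(nat \<Rightarrow>\<^sub>0 nat) \<Rightarrow>\<^sub>0 complex"

definition eval_poly :: "cpoly \<Rightarrow> cvec \<Rightarrow> complex" where
  "eval_poly p v = (\<Sum>m\<in>Poly_Mapping.keys p. Poly_Mapping.lookup p m * (\<Prod>i\<in>Poly_Mapping.keys m. v i ^ Poly_Mapping.lookup m i))"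

definition homogeneous :: "nat \<Rightarrow> nat \<Rightarrow> cpoly \<Rightarrow> bool" where
  "homogeneous n k p \<longleftrightarrow>
     (\<forall>m\<in>Poly_Mapping.keys p. Poly_Mapping.keys m \<subseteq> {..n} \<and> (\<Sum>i\<in>Poly_Mapping.keys m. Poly_Mapping.lookup m i) = k)"

definition basic_open :: "nat \<Rightarrow> cpoly \<Rightarrow> pt set" where
  "basic_open n p = {P \<in> proj_space n. \<forall>v\<in>P. eval_poly p v \<noteq> 0}"

definition zariski :: "nat \<Rightarrow> pt topology" where
  "zariski n = topology_generated_by {basic_open n p |p k. homogeneous n k p}"

lemma topspace_zariski: "topspace (zariski n) = proj_space n"
proof -
  have "homogeneous n 0 (1 :: cpoly)" "basic_open n (1 :: cpoly) = proj_space n"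
    by (auto simp: homogeneous_def basic_open_def eval_poly_def)
  then show ?thesis
    unfolding zariski_def topology_generated_by_topspace
    by (force simp: basic_open_def)
qed

abbreviation ztop :: "nat \<Rightarrow> pt set \<Rightarrow> pt topology" where
  "ztop n X \<equiv> subtopology (zariski n) X"


section \<open>Smooth projective curves\<close>

definition irreducible_in :: "'a topology \<Rightarrow> 'a set \<Rightarrow> bool" where
  "irreducible_in T S \<longleftrightarrow> S \<noteq> {} \<and> S \<subseteq> topspace T \<and>
     (\<forall>A B. closedin T A \<and> closedin T B \<and> S \<subseteq> A \<union> B \<longrightarrow> S \<subseteq> A \<or> S \<subseteq> B)"

definition krull_dim :: "'a topology \<Rightarrow> enat" where
  "krull_dim T = Sup {enat m |m. \<exists>Z.
     (\<forall>i\<le>m. closedin T (Z i) \<and> irreducible_in T (Z i)) \<and> (\<forall>i<m. Z i \<subset> Z (Suc i))}"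

text \<open>
  Regular functions on an open subset \<open>U\<close> of \<open>X\<close>. Functions are total; their values outside
  \<open>U\<close> are irrelevant.
\<close>

definition regular_on :: "nat \<Rightarrow> pt set \<Rightarrow> pt set \<Rightarrow> (pt \<Rightarrow> complex) \<Rightarrow> bool" where
  "regular_on n X U f \<longleftrightarrow> openin (ztop n X) U \<and>
     (\<forall>x\<in>U. \<exists>W k p q. openin (ztop n X) W \<and> x \<in> W \<and> W \<subseteq> U \<and>
        homogeneous n k p \<and> homogeneous n k q \<and>
        (\<forall>y\<in>W. \<forall>v\<in>y. eval_poly q v \<noteq> 0 \<and> f y = eval_poly p v / eval_poly q v))"

text \<open>The germ of \<open>t\<close> at \<open>x\<close> generates the maximal ideal of the local ring of \<open>X\<close> at \<open>x\<close>.\<close>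

definition local_parameter :: "nat \<Rightarrow> pt set \<Rightarrow> pt \<Rightarrow> (pt \<Rightarrow> complex) \<Rightarrow> bool" where
  "local_parameter n X x t \<longleftrightarrow> t x = 0 \<and> (\<exists>W. x \<in> W \<and> regular_on n X W t) \<and>
     (\<forall>W g. x \<in> W \<and> regular_on n X W g \<and> g x = 0 \<longrightarrow>
        (\<exists>V h. x \<in> V \<and> V \<subseteq> W \<and> regular_on n X V h \<and> (\<forall>y\<in>V. g y = t y * h y)))"

text \<open>
  In dimension one, smoothness at \<open>x\<close> (the local ring at \<open>x\<close> is regular) says that the
  maximal ideal of the local ring is generated by a single element.
\<close>

definition smooth_projective_curve :: "nat \<Rightarrow> pt set \<Rightarrow> bool" where
  "smooth_projective_curve n X \<longleftrightarrow>
     closedin (zariski n) X \<and> irreducible_in (zariski n) X \<and> krull_dim (ztop n X) = 1 \<and>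
     (\<forall>x\<in>X. \<exists>t. local_parameter n X x t)"

definition marked_curve :: "nat \<Rightarrow> pt set \<Rightarrow> pt set \<Rightarrow> bool" where
  "marked_curve n X D \<longleftrightarrow>
     smooth_projective_curve n X \<and> D \<subseteq> X \<and> finite D \<and> card D \<ge> 1"

text \<open>
  \<open>f\<close> is regular and nonvanishing on a punctured neighbourhood of \<open>x\<close> and has order \<open>m\<close>
  at \<open>x\<close>. The value of \<open>f\<close> at \<open>x\<close> itself is irrelevant.
\<close>

definition has_order :: "nat \<Rightarrow> pt set \<Rightarrow> pt \<Rightarrow> (pt \<Rightarrow> complex) \<Rightarrow> int \<Rightarrow> bool" where
  "has_order n X x f m \<longleftrightarrow> (\<exists>W t u. x \<in> W \<and> local_parameter n X x t \<and>
     regular_on n X W t \<and> regular_on n X W u \<and>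
     (\<forall>y\<in>W. u y \<noteq> 0) \<and> (\<forall>y\<in>W - {x}. t y \<noteq> 0 \<and> f y = t y powi m * u y))"


section \<open>Vector bundles\<close>

text \<open>
  A vector bundle consists of a vector space over each point and an atlas of local frames
  (equivalently, local trivialisations) whose changes of frame are regular. Fibres are
  finite-dimensional subspaces of the sequence space; since that space has subspaces of every
  finite dimension, every vector bundle is isomorphic to one of this form. No compatibility
  between the atlas and the ambient sequence space is required. The members
  \<open>e 0, \<dots>, e (rk E - 1)\<close> of a pair \<open>(U, e)\<close> form the frame over \<open>U\<close>.
\<close>

record vbundle =
  rk :: nat
  fibre :: "pt \<Rightarrow> cvec set"
  atlas :: "(pt set \<times> (nat \<Rightarrow> pt \<Rightarrow> cvec)) set"

definition regular_section :: "nat \<Rightarrow> pt set \<Rightarrow> vbundle \<Rightarrow> pt set \<Rightarrow> (pt \<Rightarrow> cvec) \<Rightarrow> bool" where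
  "regular_section n X E U s \<longleftrightarrow> openin (ztop n X) U \<and> (\<forall>x\<in>U. s x \<in> fibre E x) \<and>
     (\<forall>(V, e)\<in>atlas E. \<exists>a. (\<forall>i<rk E. regular_on n X (U \<inter> V) (a i)) \<and>
        (\<forall>x\<in>U \<inter> V. s x = (\<Sum>i<rk E. cscale (a i x) (e i x))))"

definition regular_frame :: "nat \<Rightarrow> pt set \<Rightarrow> vbundle \<Rightarrow> pt set \<Rightarrow> (nat \<Rightarrow> pt \<Rightarrow> cvec) \<Rightarrow> bool" where
  "regular_frame n X E U e \<longleftrightarrow> openin (ztop n X) U \<and>
     (\<forall>i<rk E. regular_section n X E U (e i)) \<and>
     (\<forall>x\<in>U. inj_on (\<lambda>i. e i x) {..<rk E} \<and> cindependent ((\<lambda>i. e i x) ` {..<rk E}) \<and>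
        cspan ((\<lambda>i. e i x) ` {..<rk E}) = fibre E x)"

definition vector_bundle :: "nat \<Rightarrow> pt set \<Rightarrow> vbundle \<Rightarrow> bool" where
  "vector_bundle n X E \<longleftrightarrow>
     (\<forall>(U, e)\<in>atlas E. regular_frame n X E U e) \<and> (\<Union>(U, e)\<in>atlas E. U) = X"

text \<open>
  A subbundle is one that is locally spanned by the first members of a frame; thus the
  inclusion is injective on fibres and the quotient is again a vector bundle.
\<close>

definition subbundle :: "nat \<Rightarrow> pt set \<Rightarrow> vbundle \<Rightarrow> vbundle \<Rightarrow> bool" where
  "subbundle n X F E \<longleftrightarrow> vector_bundle n X F \<and> vector_bundle n X E \<and> rk F \<le> rk E \<and>
     (\<forall>x\<in>X. \<exists>U e. x \<in> U \<and> regular_frame n X E U e \<and> regular_frame n X F U e)"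

text \<open>
  A frame \<open>s\<close> of \<open>E\<close> over \<open>U\<close> gives the rational section \<open>s 0 \<and> \<dots> \<and> s (r-1)\<close> of the
  determinant line bundle of \<open>E\<close>. Its order at \<open>x\<close> is the order of \<open>det A\<close>, where \<open>A\<close>
  expresses \<open>s\<close> in terms of a frame \<open>e\<close> around \<open>x\<close>.
\<close>

definition has_det_order ::
  "nat \<Rightarrow> pt set \<Rightarrow> vbundle \<Rightarrow> pt set \<Rightarrow> (nat \<Rightarrow> pt \<Rightarrow> cvec) \<Rightarrow> pt \<Rightarrow> int \<Rightarrow> bool" where
  "has_det_order n X E U s x m \<longleftrightarrow> (\<exists>W e A. x \<in> W \<and> regular_frame n X E W e \<and>
     W - {x} \<subseteq> U \<and>
     (\<forall>y\<in>W \<inter> U. \<forall>j<rk E. s j y = (\<Sum>i<rk E. cscale (A y i j) (e i y))) \<and>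
     has_order n X x (\<lambda>y. Determinant.det (mat (rk E) (rk E) (\<lambda>(i, j). A y i j))) m)"

text \<open>
  The degree of the determinant line bundle: the number of zeros minus the number of poles of
  a nonzero rational section. It does not depend on the section; at the points of \<open>U\<close>
  the order is zero, and \<open>X - U\<close> is finite.
\<close>

definition degree :: "nat \<Rightarrow> pt set \<Rightarrow> vbundle \<Rightarrow> int" where
  "degree n X E = (THE d. \<exists>U s. U \<noteq> {} \<and> regular_frame n X E U s \<and>
     d = (\<Sum>x\<in>X - U. THE m. has_det_order n X E U s x m))"


section \<open>Parabolic structures and stability\<close>

text \<open>Flag members are indexed by \<open>1, \<dots>, r + 1\<close>, where \<open>r\<close> is the rank.\<close>

definition full_flag_bundle ::
  "nat \<Rightarrow> pt set \<Rightarrow> pt set \<Rightarrow> vbundle \<Rightarrow> (pt \<Rightarrow> nat \<Rightarrow> cvec set) \<Rightarrow> bool" where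
  "full_flag_bundle n X D E fl \<longleftrightarrow> vector_bundle n X E \<and>
     (\<forall>x\<in>D. fl x 1 = fibre E x \<and> fl x (rk E + 1) = {0} \<and>
        (\<forall>i\<in>{1..rk E + 1}. csubspace (fl x i)) \<and>
        (\<forall>i\<in>{1..rk E}. fl x (i + 1) \<subset> fl x i))"

definition flag_mult :: "(pt \<Rightarrow> nat \<Rightarrow> cvec set) \<Rightarrow> vbundle \<Rightarrow> pt \<Rightarrow> nat \<Rightarrow> int" where
  "flag_mult fl F x i =
     int (cdim (fibre F x \<inter> fl x i)) - int (cdim (fibre F x \<inter> fl x (i + 1)))"

definition pardeg ::
  "nat \<Rightarrow> pt set \<Rightarrow> pt set \<Rightarrow> nat \<Rightarrow> (pt \<Rightarrow> nat \<Rightarrow> cvec set) \<Rightarrow> (pt \<Rightarrow> nat \<Rightarrow> real) \<Rightarrow> vbundle \<Rightarrow> real"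
  where
  "pardeg n X D r fl \<alpha> F =
     of_int (degree n X F) + (\<Sum>x\<in>D. \<Sum>i=1..r. of_int (flag_mult fl F x i) * \<alpha> x i)"

definition semistable ::
  "nat \<Rightarrow> pt set \<Rightarrow> pt set \<Rightarrow> (pt \<Rightarrow> nat \<Rightarrow> real) \<Rightarrow> vbundle \<Rightarrow> (pt \<Rightarrow> nat \<Rightarrow> cvec set) \<Rightarrow> bool" where
  "semistable n X D \<alpha> E fl \<longleftrightarrow>
     (\<forall>F. subbundle n X F E \<and> rk F \<noteq> 0 \<and> (\<exists>x\<in>X. fibre F x \<noteq> fibre E x) \<longrightarrow>
        pardeg n X D (rk E) fl \<alpha> F / rk F \<le> pardeg n X D (rk E) fl \<alpha> E / rk E)"

definition weight_space :: "pt set \<Rightarrow> nat \<Rightarrow> (pt \<Rightarrow> nat \<Rightarrow> real) set" where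
  "weight_space D r = {\<alpha> \<in> D \<rightarrow>\<^sub>E ({1..r} \<rightarrow>\<^sub>E {0..<1}). \<forall>x\<in>D. \<forall>i\<in>{1..r-1}. \<alpha> x i < \<alpha> x (i + 1)}"

definition same_chamber ::
  "nat \<Rightarrow> pt set \<Rightarrow> pt set \<Rightarrow> nat \<Rightarrow> int \<Rightarrow> ((pt \<Rightarrow> nat \<Rightarrow> real) \<times> (pt \<Rightarrow> nat \<Rightarrow> real)) set" where
  "same_chamber n X D r d = {(\<alpha>, \<beta>). \<alpha> \<in> weight_space D r \<and> \<beta> \<in> weight_space D r \<and>
     (\<forall>E fl. full_flag_bundle n X D E fl \<and> rk E = r \<and> degree n X E = d \<longrightarrow>
        (semistable n X D \<alpha> E fl \<longleftrightarrow> semistable n X D \<beta> E fl))}"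

lemma equiv_same_chamber: "equiv (weight_space D r) (same_chamber n X D r d)"
  by (auto simp: same_chamber_def intro!: equivI refl_onI symI transI)

definition stability_chambers :: "nat \<Rightarrow> pt set \<Rightarrow> pt set \<Rightarrow> nat \<Rightarrow> int \<Rightarrow> (pt \<Rightarrow> nat \<Rightarrow> real) set set" where
  "stability_chambers n X D r d = weight_space D r // same_chamber n X D r d"

end

theory Submission
  imports Defs
begin

text \<open>
  Stability is decided by finitely many linear inequalities on the weights. Whether a subbundle
  \<open>F\<close> destabilises \<open>E\<close> depends only on the numerical data \<open>(rk F, deg F, n\<^sup>F, n\<^sup>E)\<close>,
  where \<open>n\<^sup>F\<close> and \<open>n\<^sup>E\<close> are the multiplicities of the flags. The multiplicities at a point are
  bounded by the rank, since they are differences of dimensions of subspaces of a fibre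
  (\<open>abs_flag_mult_le\<close>), so there are finitely many possibilities for the ranks and the
  multiplicities. The degree of \<open>F\<close> is not bounded: nothing prevents a bundle from having
  subbundles of very negative degree, or the family of all bundles from having subbundles of
  arbitrarily large degree. But weights lie in \<open>[0, 1)\<close>, so the weights change a parabolic degree
  by a bounded amount only. Hence, once \<open>\<bar>deg F\<bar>\<close> exceeds a bound in terms of \<open>d\<close>, \<open>r\<close> and
  \<open>\<bar>D\<bar>\<close>, the truth value of the inequality for \<open>F\<close> is the same for all weights
  (\<open>slope_le_large_degree\<close>).

  Therefore the truth values of the inequalities for the finitely many remaining numerical data
  determine the stability chamber of a system of weights (\<open>same_chamber_if_same_slope_le\<close>), and
  there are only finitely many assignments of truth values to a finite set.
\<close>

lemma finite_quotient_if_invariant: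
  assumes equiv: "equiv A R"
    and fin: "finite (f ` A)"
    and invariant: "\<And>a b. a \<in> A \<Longrightarrow> b \<in> A \<Longrightarrow> f a = f b \<Longrightarrow> (a, b) \<in> R"
  shows "finite (A // R)"
proof -
  have "A // R \<subseteq> (\<lambda>y. R `` {inv_into A f y}) ` f ` A"
  proof
    fix Q assume "Q \<in> A // R"
    then obtain a where a: "a \<in> A" and Q: "Q = R `` {a}"
      by (auto elim: quotientE)
    let ?b = "inv_into A f (f a)"
    have "?b \<in> A" "f ?b = f a"
      using a by (auto intro: inv_into_into f_inv_into_f)
    then have "Q = R `` {?b}"
      unfolding Q using a by (metis equiv equiv_class_eq invariant)
    then show "Q \<in> (\<lambda>y. R `` {inv_into A f y}) ` f ` A"
      using a by blast
  qed
  then show ?thesis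
    using fin by (meson finite_imageI finite_subset)
qed


lemma cdim_subset_fibre_le:
  assumes "vector_bundle n X G" "x \<in> X" "V \<subseteq> fibre G x"
  shows "cdim V \<le> rk G"
proof -
  obtain U e where "(U, e) \<in> atlas G" "x \<in> U" "regular_frame n X G U e"
    using assms(1,2) unfolding vector_bundle_def by fastforce
  then have span: "cspan ((\<lambda>i. e i x) ` {..<rk G}) = fibre G x"
    unfolding regular_frame_def by blast
  have "cdim V \<le> card ((\<lambda>i. e i x) ` {..<rk G})"
    by (rule cvec.dim_le_card) (use assms(3) span in auto)
  also have "\<dots> \<le> rk G"
    using card_image_le[of "{..<rk G}" "\<lambda>i. e i x"] by simp
  finally show ?thesis .
qed

text \<open>
  For a full flag a multiplicity is \<open>0\<close> or \<open>1\<close>, but finiteness only requires some bound, and a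
  difference of two dimensions that are each at most the rank has an obvious one.
\<close>

lemma abs_flag_mult_le:
  assumes "vector_bundle n X G" "x \<in> X"
  shows "\<bar>flag_mult fl G x i\<bar> \<le> int (rk G)"
proof -
  have "cdim (fibre G x \<inter> fl x j) \<le> rk G" for j
    using cdim_subset_fibre_le[OF assms] by blast
  from this[of i] this[of "i + 1"] show ?thesis
    unfolding flag_mult_def by linarith
qed


definition weight_sum ::
  "pt set \<Rightarrow> nat \<Rightarrow> (pt \<Rightarrow> nat \<Rightarrow> int) \<Rightarrow> (pt \<Rightarrow> nat \<Rightarrow> real) \<Rightarrow> real" where
  "weight_sum D r m \<alpha> = (\<Sum>x\<in>D. \<Sum>i=1..r. of_int (m x i) * \<alpha> x i)"

text \<open>
  The functions are extensional, so that there are finitely many of them for finite \<open>D\<close>.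
\<close>

definition mult_space :: "pt set \<Rightarrow> nat \<Rightarrow> (pt \<Rightarrow> nat \<Rightarrow> int) set" where
  "mult_space D r = D \<rightarrow>\<^sub>E ({1..r} \<rightarrow>\<^sub>E {- int r..int r})"

definition mults :: "pt set \<Rightarrow> nat \<Rightarrow> (pt \<Rightarrow> nat \<Rightarrow> cvec set) \<Rightarrow> vbundle \<Rightarrow> pt \<Rightarrow> nat \<Rightarrow> int" where
  "mults D r fl G = (\<lambda>x\<in>D. \<lambda>i\<in>{1..r}. flag_mult fl G x i)"

lemma pardeg_eq_weight_sum:
  "pardeg n X D r fl \<alpha> G = of_int (degree n X G) + weight_sum D r (mults D r fl G) \<alpha>"
  unfolding pardeg_def weight_sum_def mults_def by simp

lemma finite_mult_space: "finite D \<Longrightarrow> finite (mult_space D r)"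
  unfolding mult_space_def by (intro finite_PiE) auto

lemma mults_in_mult_space:
  assumes "vector_bundle n X G" "rk G \<le> r" "D \<subseteq> X"
  shows "mults D r fl G \<in> mult_space D r"
proof -
  have "flag_mult fl G x i \<in> {- int r..int r}" if "x \<in> D" for x i
  proof -
    have "\<bar>flag_mult fl G x i\<bar> \<le> int (rk G)"
      using assms(1,3) that by (intro abs_flag_mult_le[of n X]) auto
    then show ?thesis
      using assms(2) by auto
  qed
  then show ?thesis
    unfolding mults_def mult_space_def by (intro restrict_PiE_iff[THEN iffD2] ballI) simp
qed

text \<open>This is where the boundedness of weights enters.\<close>

lemma abs_weight_sum_le:
  assumes m: "m \<in> mult_space D r" and \<alpha>: "\<alpha> \<in> weight_space D r"
  shows "\<bar>weight_sum D r m \<alpha>\<bar> \<le> real (card D * r * r)"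
proof -
  have term_le: "\<bar>of_int (m x i) * \<alpha> x i\<bar> \<le> real r" if "x \<in> D" "i \<in> {1..r}" for x i
  proof -
    have "m x i \<in> {- int r..int r}"
      using m that unfolding mult_space_def by (auto simp: PiE_iff)
    then have 1: "\<bar>of_int (m x i) :: real\<bar> \<le> real r"
      by (simp add: abs_le_iff)
    have "\<alpha> x i \<in> {0..<1}"
      using \<alpha> that unfolding weight_space_def by (auto simp: PiE_iff)
    then have "\<bar>\<alpha> x i\<bar> \<le> 1"
      by simp
    with 1 show ?thesis
      using mult_mono[of "\<bar>of_int (m x i)\<bar>" "real r" "\<bar>\<alpha> x i\<bar>" 1] by (simp add: abs_mult)
  qed
  have "\<bar>weight_sum D r m \<alpha>\<bar> \<le> (\<Sum>x\<in>D. \<bar>\<Sum>i=1..r. of_int (m x i) * \<alpha> x i\<bar>)"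
    unfolding weight_sum_def by (rule sum_abs)
  also have "\<dots> \<le> (\<Sum>x\<in>D. \<Sum>i=1..r. \<bar>of_int (m x i) * \<alpha> x i\<bar>)"
    by (intro sum_mono sum_abs)
  also have "\<dots> \<le> (\<Sum>x\<in>D. \<Sum>i=1..r. real r)"
    by (intro sum_mono term_le)
  finally show ?thesis
    by simp
qed


text \<open>
  Here \<open>(k, e, m)\<close> are the rank, degree and multiplicities of a subbundle and \<open>m'\<close> are the
  multiplicities of the ambient bundle. As the weights move, the truth value can only change at
  the locus of equality, where the walls between chambers lie.
\<close>

definition slope_le ::
  "pt set \<Rightarrow> nat \<Rightarrow> int \<Rightarrow> (pt \<Rightarrow> nat \<Rightarrow> real) \<Rightarrow>
   nat \<times> int \<times> (pt \<Rightarrow> nat \<Rightarrow> int) \<times> (pt \<Rightarrow> nat \<Rightarrow> int) \<Rightarrow> bool" where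
  "slope_le D r d \<alpha> = (\<lambda>(k, e, m, m').
     (of_int e + weight_sum D r m \<alpha>) / real k \<le> (of_int d + weight_sum D r m' \<alpha>) / real r)"

text \<open>
  With \<open>C = \<bar>D\<bar> r\<^sup>2\<close> bounding both weight sums, the right-hand slope is at most \<open>\<bar>d\<bar> + C\<close> in
  absolute value; multiply by the rank \<open>k \<le> r\<close> and add \<open>C\<close> for the weight sum of the subbundle.
\<close>

definition degree_bound :: "pt set \<Rightarrow> nat \<Rightarrow> int \<Rightarrow> int" where
  "degree_bound D r d = int r * (\<bar>d\<bar> + int (card D * r * r)) + int (card D * r * r)"

text \<open>
  Beyond the bound, \<open>\<alpha>\<close> does not appear on the right-hand side: very negative degrees never
  destabilise and very positive ones always do.
\<close>

lemma slope_le_large_degree: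
  assumes \<alpha>: "\<alpha> \<in> weight_space D r"
    and m: "m \<in> mult_space D r" "m' \<in> mult_space D r"
    and k: "1 \<le> k" "k \<le> r"
    and large: "\<bar>e\<bar> > degree_bound D r d"
  shows "slope_le D r d \<alpha> (k, e, m, m') \<longleftrightarrow> e < 0"
proof -
  define C where "C = real (card D * r * r)"
  define S where "S = weight_sum D r m \<alpha>"
  define q where "q = (of_int d + weight_sum D r m' \<alpha>) / real r"
  have S: "\<bar>S\<bar> \<le> C" and S': "\<bar>weight_sum D r m' \<alpha>\<bar> \<le> C"
    unfolding S_def C_def using abs_weight_sum_le \<alpha> m by blast+
  have "real_of_int (degree_bound D r d) = real r * (\<bar>of_int d\<bar> + C) + C"
    unfolding degree_bound_def C_def by simp
  then have e: "real r * (\<bar>of_int d\<bar> + C) + C < \<bar>of_int e\<bar>"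
    using large by (metis of_int_abs of_int_less_iff)
  have "\<bar>q\<bar> * real r = \<bar>of_int d + weight_sum D r m' \<alpha>\<bar>"
    unfolding q_def using k by simp
  also have "\<dots> \<le> \<bar>of_int d\<bar> + C"
    using S' by linarith
  finally have "\<bar>q\<bar> * real r \<le> \<bar>of_int d\<bar> + C" .
  moreover have "\<bar>q\<bar> * 1 \<le> \<bar>q\<bar> * real r"
    using k by (intro mult_left_mono) auto
  ultimately have "\<bar>q\<bar> \<le> \<bar>of_int d\<bar> + C"
    by linarith
  then have "\<bar>q * real k\<bar> \<le> real r * (\<bar>of_int d\<bar> + C)"
    using mult_mono[of "\<bar>q\<bar>" "\<bar>of_int d\<bar> + C" "real k" "real r"] k
    by (simp add: abs_mult mult.commute)
  with S e have "of_int e + S \<le> q * real k \<longleftrightarrow> real_of_int e < 0"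
    by linarith
  moreover have "(of_int e + S) / real k \<le> q \<longleftrightarrow> of_int e + S \<le> q * real k"
    using k by (simp add: pos_divide_le_eq)
  ultimately show ?thesis
    unfolding slope_le_def S_def q_def by simp
qed

definition critical_data ::
  "pt set \<Rightarrow> nat \<Rightarrow> int \<Rightarrow> (nat \<times> int \<times> (pt \<Rightarrow> nat \<Rightarrow> int) \<times> (pt \<Rightarrow> nat \<Rightarrow> int)) set" where
  "critical_data D r d =
     {1..r} \<times> {- degree_bound D r d..degree_bound D r d} \<times> mult_space D r \<times> mult_space D r"

lemma finite_critical_data: "finite D \<Longrightarrow> finite (critical_data D r d)"
  unfolding critical_data_def by (simp add: finite_mult_space)

lemma slope_le_eq_if_eq_on_critical:
  assumes \<alpha>: "\<alpha> \<in> weight_space D r" and \<beta>: "\<beta> \<in> weight_space D r"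
    and same: "\<And>t. t \<in> critical_data D r d \<Longrightarrow> slope_le D r d \<alpha> t = slope_le D r d \<beta> t"
    and m: "m \<in> mult_space D r" "m' \<in> mult_space D r"
    and k: "1 \<le> k" "k \<le> r"
  shows "slope_le D r d \<alpha> (k, e, m, m') = slope_le D r d \<beta> (k, e, m, m')"
proof (cases "\<bar>e\<bar> > degree_bound D r d")
  case True
  then show ?thesis
    using slope_le_large_degree \<alpha> \<beta> m k by blast
next
  case False
  then have "(k, e, m, m') \<in> critical_data D r d"
    unfolding critical_data_def using m k by auto
  then show ?thesis
    by (rule same)
qed

lemma semistable_iff_slope_le:
  assumes "rk E = r" "degree n X E = d"
  shows "semistable n X D \<alpha> E fl \<longleftrightarrow>
    (\<forall>F. subbundle n X F E \<and> rk F \<noteq> 0 \<and> (\<exists>x\<in>X. fibre F x \<noteq> fibre E x) \<longrightarrow>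
       slope_le D r d \<alpha> (rk F, degree n X F, mults D r fl F, mults D r fl E))"
  unfolding semistable_def slope_le_def using assms by (simp add: pardeg_eq_weight_sum)

lemma same_chamber_if_same_slope_le:
  assumes D: "D \<subseteq> X"
    and \<alpha>: "\<alpha> \<in> weight_space D r" and \<beta>: "\<beta> \<in> weight_space D r"
    and same: "\<And>t. t \<in> critical_data D r d \<Longrightarrow> slope_le D r d \<alpha> t = slope_le D r d \<beta> t"
  shows "(\<alpha>, \<beta>) \<in> same_chamber n X D r d"
proof -
  have "semistable n X D \<alpha> E fl \<longleftrightarrow> semistable n X D \<beta> E fl"
    if rk: "rk E = r" and deg: "degree n X E = d" for E fl
  proof -
    have "slope_le D r d \<alpha> (rk F, degree n X F, mults D r fl F, mults D r fl E) =
          slope_le D r d \<beta> (rk F, degree n X F, mults D r fl F, mults D r fl E)"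
      if "subbundle n X F E" "rk F \<noteq> 0" for F
    proof (rule slope_le_eq_if_eq_on_critical[OF \<alpha> \<beta> same])
      have "vector_bundle n X F" "vector_bundle n X E" "rk F \<le> r"
        using that rk unfolding subbundle_def by auto
      then show "mults D r fl F \<in> mult_space D r" "mults D r fl E \<in> mult_space D r" "rk F \<le> r"
        using mults_in_mult_space D rk by auto
      show "1 \<le> rk F"
        using that by simp
    qed
    then show ?thesis
      unfolding semistable_iff_slope_le[OF rk deg] by metis
  qed
  then show ?thesis
    unfolding same_chamber_def using \<alpha> \<beta> by blast
qed

theorem proposition10p3:
  fixes n r :: nat and X D :: "pt set" and d :: int
  assumes "marked_curve n X D"
    and "r \<ge> 2"
  shows "finite (stability_chambers n X D r d)"
proof -
  have D: "D \<subseteq> X" "finite D"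
    using assms(1) unfolding marked_curve_def by auto
  let ?sat = "\<lambda>\<alpha>. {t \<in> critical_data D r d. slope_le D r d \<alpha> t}"
  have "?sat ` weight_space D r \<subseteq> Pow (critical_data D r d)"
    by blast
  then have "finite (?sat ` weight_space D r)"
    using finite_critical_data[OF D(2)] by (meson finite_Pow_iff finite_subset)
  then show ?thesis
    unfolding stability_chambers_def
  proof (rule finite_quotient_if_invariant[OF equiv_same_chamber])
    fix \<alpha> \<beta>
    assume "\<alpha> \<in> weight_space D r" "\<beta> \<in> weight_space D r" "?sat \<alpha> = ?sat \<beta>"
    then show "(\<alpha>, \<beta>) \<in> same_chamber n X D r d"
      by (intro same_chamber_if_same_slope_le D(1)) blast+
  qed
qed

end
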